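(* For every $r=r(q)$ there is a critical probability $p=p(r,q)$ such that for every $\epsilon>0$: (1) $\mathbb{P}\left(\text{AP}_r(p(1-\epsilon))=1\right)=o(1)$, and (2) $\mathbb{P}\left(\text{AP}_r(p(1+\epsilon))=1\right)=1-o(1)$, as $q\to\infty$ over prime powers.
   Context: Let $\mathbb{F}_q=\{a_1,\ldots,a_q\}$, and assume $rq$ is an integer. $\text{AP}_r:\{0,1\}^{q\times q}\to\{0,1\}$: identifying $\mathbb{F}_q^2$ with the $q^2$ input coordinates, an input is the indicator of a set $S\subseteq\mathbb{F}_q^2$, and $\text{AP}_r(S)=1$ iff there is a polynomial $P$ over $\mathbb{F}_q$ of degree at most $rq$ with $(a_i,P(a_i))\in S$ for all $i\in[q]$. For $p\in(0,1)$, $\text{AP}_r(p)$ denotes $\text{AP}_r$ evaluated on $q^2$ independent $\mathrm{Ber}(p)$ input bits. *)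

theory Defs
  imports
    "HOL-Algebra.Polynomials"
    "HOL-Number_Theory.Prime_Powers"
    "HOL-Probability.Product_PMF"
begin

text \<open>
  A polynomial over \<open>R\<close> is a coefficient list whose leading coefficient is nonzero, the zero
  polynomial being \<open>[]\<close>. Its degree is \<open>-\<infinity>\<close> here, whereas the library sets it to \<open>0\<close>; the
  disjunct \<open>P = []\<close> only matters if \<open>r < 0\<close>.
\<close>

definition AP :: "('a, 'm) ring_scheme \<Rightarrow> real \<Rightarrow> ('a \<times> 'a) set \<Rightarrow> bool" where
  "AP R r S \<longleftrightarrow>
     (\<exists>P \<in> carrier (univ_poly R (carrier R)).
        (P = [] \<or> real (Polynomials.degree P) \<le> r * real (card (carrier R))) \<and>
        (\<forall>a \<in> carrier R. (a, ring.eval R P a) \<in> S))"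

text \<open>
  Note that \<open>bernoulli_pmf p\<close> truncates its parameter to \<open>[0, 1]\<close>: it is the point mass at
  \<open>False\<close> if \<open>p \<le> 0\<close> and at \<open>True\<close> if \<open>p \<ge> 1\<close>.
\<close>

definition random_points :: "('a, 'm) ring_scheme \<Rightarrow> real \<Rightarrow> ('a \<times> 'a) set pmf" where
  "random_points R p =
     map_pmf Collect (Pi_pmf (carrier R \<times> carrier R) False (\<lambda>_. bernoulli_pmf p))"

definition AP_prob :: "('a, 'm) ring_scheme \<Rightarrow> real \<Rightarrow> real \<Rightarrow> real" where
  "AP_prob R r p = measure_pmf.prob (random_points R p) {S. AP R r S}"

definition at_primepows :: "nat filter" where
  "at_primepows = inf at_top (principal {q. primepow q})"

end

theory Submission
  imports Defs "HOL-Algebra.Polynomial_Divisibility" "HOL-Real_Asymp.Real_Asymp"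
begin

text \<open>
  Let \<open>K\<close> be the dimension of the space of admissible polynomials, \<open>k = min K q\<close>, and call the
  points over one \<open>a \<in> F\<close> a column. For \<open>K > 0\<close> the critical probability is
  \<open>max (ln q / q) (q powr - (k / q))\<close>. Below \<open>ln q / q\<close> some column is empty; below
  \<open>q powr - (k / q)\<close> the expected number \<open>q\<^sup>k p\<^sup>q\<close> of contained polynomials tends to \<open>0\<close>.

  Above both values the plain second moment fails, because the column sizes \<open>s\<close> fluctuate. We
  therefore normalise: a point in a column of size \<open>s\<close> gets weight \<open>q / s\<close>, and \<open>Y\<close> is the average
  over all polynomials of the product of the weights along the graph. With \<open>m\<close> the probability
  that a column is nonempty, \<open>E Y = m\<^sup>q\<close>. For two polynomials the product of the weights has
  expectation \<open>\<beta>\<close> to the number of agreements times \<open>\<gamma>\<close> to the number of disagreements, where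
  \<open>\<beta> + (q - 1) \<gamma> = q m\<close>. Expanding \<open>\<beta> = \<gamma> + (\<beta> - \<gamma>)\<close> over sets \<open>T\<close> of agreements and using that
  a polynomial prescribed on \<open>T\<close> has at most \<open>max (q\<^bsup>k - |T|\<^esup>) 1\<close> extensions gives
  \<open>E Y\<^sup>2 \<le> m\<^sup>q + \<beta>\<^sup>q / q\<^sup>k\<close>. Hence \<open>P (Y = 0) \<le> E (1 - Y)\<^sup>2 \<le> 1 - m\<^sup>q + \<beta>\<^sup>q / q\<^sup>k\<close>, and
  \<open>\<beta> = q E (1 / s)\<close> is close to \<open>1 / p\<close>.
\<close>

section \<open>Random columns\<close>

definition random_column :: "'b set \<Rightarrow> real \<Rightarrow> ('b \<Rightarrow> bool) pmf" where
  "random_column B p = Pi_pmf B False (\<lambda>_. bernoulli_pmf p)"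

lemma finite_set_random_column:
  assumes "finite B"
  shows "finite (set_pmf (random_column B p))"
  unfolding random_column_def using assms
  by (simp add: set_Pi_pmf finite_PiE_dflt)

lemma integrable_random_column:
  fixes f :: "('b \<Rightarrow> bool) \<Rightarrow> real"
  assumes "finite B"
  shows "integrable (random_column B p) f"
  by (intro integrable_measure_pmf_finite finite_set_random_column assms)

lemma Pi_pmf_Times:
  assumes "finite A" "finite B"
  shows "Pi_pmf (A \<times> B) d (\<lambda>_. M) =
           map_pmf case_prod (Pi_pmf A (\<lambda>_. d) (\<lambda>_. Pi_pmf B d (\<lambda>_. M)))"
proof (rule pmf_eqI)
  fix f :: "'a \<times> 'b \<Rightarrow> 'c"
  have inj: "inj (case_prod :: ('a \<Rightarrow> 'b \<Rightarrow> 'c) \<Rightarrow> _)"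
    by (metis injI curry_case_prod)
  have "pmf (map_pmf case_prod (Pi_pmf A (\<lambda>_. d) (\<lambda>_. Pi_pmf B d (\<lambda>_. M)))) (case_prod (curry f)) =
          pmf (Pi_pmf A (\<lambda>_. d) (\<lambda>_. Pi_pmf B d (\<lambda>_. M))) (curry f)"
    by (rule pmf_map_inj') (rule inj)
  also have "\<dots> = pmf (Pi_pmf (A \<times> B) d (\<lambda>_. M)) f"
  proof (cases "\<forall>x. x \<notin> A \<times> B \<longrightarrow> f x = d")
    case True
    then show ?thesis
      using assms by (simp add: pmf_Pi curry_def fun_eq_iff prod.cartesian_product)
  next
    case False
    then obtain a b where ab: "(a, b) \<notin> A \<times> B" "f (a, b) \<noteq> d" by auto
    show ?thesis
    proof (cases "a \<in> A")
      case True
      with ab have "pmf (Pi_pmf B d (\<lambda>_. M)) (curry f a) = 0"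
        using assms by (intro pmf_Pi_outside) auto
      with True False show ?thesis
        using assms by (subst (1 2) pmf_Pi) (auto simp: prod_zero_iff)
    next
      case a: False
      with ab have "curry f a \<noteq> (\<lambda>_. d)" by (auto simp: fun_eq_iff)
      with a False show ?thesis
        using assms by (subst (1 2) pmf_Pi) auto
    qed
  qed
  finally show "pmf (Pi_pmf (A \<times> B) d (\<lambda>_. M)) f =
      pmf (map_pmf case_prod (Pi_pmf A (\<lambda>_. d) (\<lambda>_. Pi_pmf B d (\<lambda>_. M)))) f"
    by simp
qed

definition random_columns :: "'i set \<Rightarrow> 'b set \<Rightarrow> real \<Rightarrow> ('i \<Rightarrow> 'b \<Rightarrow> bool) pmf" where
  "random_columns I B p = Pi_pmf I (\<lambda>_. False) (\<lambda>_. random_column B p)"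

lemma random_points_conv_columns:
  assumes "finite (carrier R)"
  shows "random_points R p =
    map_pmf (\<lambda>g. {(x, y). g x y}) (random_columns (carrier R) (carrier R) p)"
  unfolding random_points_def random_columns_def random_column_def
  by (simp add: Pi_pmf_Times[OF assms assms] map_pmf_comp)

lemma prob_random_column_hit:
  assumes "finite B" "y \<in> B" "0 \<le> p" "p \<le> 1"
  shows "measure_pmf.prob (random_column B p) {h. h y} = p"
proof -
  have "measure_pmf.prob (random_column B p) {h. h y} =
          measure_pmf.prob (map_pmf (\<lambda>h. h y) (random_column B p)) {True}"
    by (simp add: vimage_def)
  also have "\<dots> = p"
    unfolding random_column_def using assms
    by (simp add: Pi_pmf_component measure_pmf_single)
  finally show ?thesis .
qed

lemma prob_random_column_nonempty:
  assumes "finite B" "0 \<le> p" "p \<le> 1"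
  shows "measure_pmf.prob (random_column B p) {h. \<exists>y\<in>B. h y} = 1 - (1 - p) ^ card B"
proof -
  have "measure_pmf.prob (random_column B p) (Pi B (\<lambda>_. {False})) = (1 - p) ^ card B"
    unfolding random_column_def using assms
    by (simp add: measure_Pi_pmf_Pi measure_pmf_single)
  moreover have "{h. \<exists>y\<in>B. h y} = UNIV - Pi B (\<lambda>_. {False})" by auto
  ultimately show ?thesis
    using measure_pmf.prob_compl[of "Pi B (\<lambda>_. {False})" "random_column B p"] by simp
qed

lemma prob_random_columns_all:
  assumes "finite I"
  shows "measure_pmf.prob (random_columns I B p) {g. \<forall>i\<in>I. g i \<in> H i} =
           (\<Prod>i\<in>I. measure_pmf.prob (random_column B p) (H i))"
proof -
  have "{g. \<forall>i\<in>I. g i \<in> H i} = Pi I H" by auto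
  with assms show ?thesis
    unfolding random_columns_def by (simp add: measure_Pi_pmf_Pi)
qed

lemma prob_columns_contain_le_nonempty:
  assumes "finite I" "finite B" "0 \<le> p" "p \<le> 1"
    and ev: "\<And>j i. j \<in> J \<Longrightarrow> i \<in> I \<Longrightarrow> ev j i \<in> B"
  shows "measure_pmf.prob (random_columns I B p) {g. \<exists>j\<in>J. \<forall>i\<in>I. g i (ev j i)}
           \<le> (1 - (1 - p) ^ card B) ^ card I"
proof -
  have "measure_pmf.prob (random_columns I B p) {g. \<exists>j\<in>J. \<forall>i\<in>I. g i (ev j i)}
        \<le> measure_pmf.prob (random_columns I B p) {g. \<forall>i\<in>I. g i \<in> {h. \<exists>y\<in>B. h y}}"
    using ev by (intro measure_pmf.finite_measure_mono) auto
  also have "\<dots> = (1 - (1 - p) ^ card B) ^ card I"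
    using assms by (subst prob_random_columns_all) (simp_all add: prob_random_column_nonempty)
  finally show ?thesis .
qed

lemma prob_columns_contain_le_first_moment:
  assumes "finite I" "finite B" "finite J" "0 \<le> p" "p \<le> 1"
    and ev: "\<And>j i. j \<in> J \<Longrightarrow> i \<in> I \<Longrightarrow> ev j i \<in> B"
  shows "measure_pmf.prob (random_columns I B p) {g. \<exists>j\<in>J. \<forall>i\<in>I. g i (ev j i)}
           \<le> card J * (p :: real) ^ card I"
proof -
  have "measure_pmf.prob (random_columns I B p) {g. \<exists>j\<in>J. \<forall>i\<in>I. g i (ev j i)} =
        measure_pmf.prob (random_columns I B p) (\<Union>j\<in>J. {g. \<forall>i\<in>I. g i \<in> {h. h (ev j i)}})"
    by (intro arg_cong[where f = "measure_pmf.prob _"]) auto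
  also have "\<dots> \<le> (\<Sum>j\<in>J. measure_pmf.prob (random_columns I B p)
                           {g. \<forall>i\<in>I. g i \<in> {h. h (ev j i)}})"
    using assms by (intro measure_pmf.finite_measure_subadditive_finite) auto
  also have "\<dots> = (\<Sum>j\<in>J. p ^ card I)"
    using assms by (intro sum.cong refl, subst prob_random_columns_all)
      (simp_all add: prob_random_column_hit)
  finally show ?thesis by simp
qed

section \<open>Moments of the column weights\<close>

definition column_weight :: "'b set \<Rightarrow> ('b \<Rightarrow> bool) \<Rightarrow> 'b \<Rightarrow> real" where
  "column_weight B h y = of_bool (h y) * card B / card {z\<in>B. h z}"

text \<open>On an empty column all weights are \<open>0\<close>, as \<open>x / 0 = 0\<close>.\<close>

lemma column_weight_nonneg: "column_weight B h y \<ge> 0"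
  by (simp add: column_weight_def)

lemma column_weight_eq_0: "\<not> h y \<Longrightarrow> column_weight B h y = 0"
  by (simp add: column_weight_def)

lemma sum_column_weight:
  assumes "finite B"
  shows "(\<Sum>y\<in>B. column_weight B h y) = real (card B) * of_bool (\<exists>y\<in>B. h y)"
proof -
  have "(\<Sum>y\<in>B. column_weight B h y) =
          (\<Sum>y\<in>B. of_bool (h y)) * real (card B) / real (card {z\<in>B. h z})"
    by (simp add: column_weight_def sum_distrib_right sum_divide_distrib)
  also have "(\<Sum>y\<in>B. of_bool (h y) :: real) = card {z\<in>B. h z}"
    using assms by (simp add: sum.If_cases of_bool_def Int_def)
  finally show ?thesis using assms by auto
qed

lemma sum_column_weight_squared:
  assumes "finite B"
  shows "(\<Sum>y\<in>B. column_weight B h y ^ 2) = (card B)\<^sup>2 / card {z\<in>B. h z}"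
proof -
  have "(\<Sum>y\<in>B. column_weight B h y ^ 2) =
          (\<Sum>y\<in>B. of_bool (h y)) * (real (card B))\<^sup>2 / (real (card {z\<in>B. h z}))\<^sup>2"
    by (simp add: column_weight_def sum_distrib_right sum_divide_distrib
        power_divide power_mult_distrib flip: of_bool_conj)
      (auto intro!: sum.cong)
  also have "(\<Sum>y\<in>B. of_bool (h y) :: real) = card {z\<in>B. h z}"
    using assms by (simp add: sum.If_cases of_bool_def Int_def)
  finally show ?thesis by (simp add: power2_eq_square)
qed

lemma column_weight_times_sum:
  assumes "finite B" "x \<in> B"
  shows "(\<Sum>y\<in>B. column_weight B h x * column_weight B h y) = card B * column_weight B h x"
proof -
  have "column_weight B h x * of_bool (\<exists>y\<in>B. h y) = column_weight B h x"
    using assms(2) column_weight_eq_0[of h x B] by (cases "h x") auto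
  then show ?thesis
    unfolding sum_distrib_left[symmetric] sum_column_weight[OF assms(1)] by (simp add: mult_ac)
qed

lemma column_weight_comp_permutes:
  assumes "\<pi> permutes B"
  shows "column_weight B (h \<circ> \<pi>) y = column_weight B h (\<pi> y)"
proof -
  have "bij_betw \<pi> {z\<in>B. h (\<pi> z)} {z\<in>B. h z}"
  proof (rule bij_betwI')
    fix z assume "z \<in> {z\<in>B. h z}"
    then show "\<exists>x\<in>{z\<in>B. h (\<pi> z)}. z = \<pi> x"
      using assms by (intro bexI[of _ "inv_into UNIV \<pi> z"])
        (auto simp: permutes_inverses permutes_in_image[OF permutes_inv[OF assms]])
  qed (use assms in \<open>auto simp: permutes_in_image dest: permutes_inj injD\<close>)
  then show ?thesis
    by (simp add: column_weight_def bij_betw_same_card)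
qed

lemma random_column_permutes:
  assumes "finite B" "\<pi> permutes B"
  shows "map_pmf (\<lambda>h. h \<circ> \<pi>) (random_column B p) = random_column B p"
  unfolding random_column_def
  by (rule Pi_pmf_bij_betw[symmetric])
    (use assms in \<open>auto simp: permutes_imp_bij permutes_in_image\<close>)

definition weight_corr :: "'b set \<Rightarrow> real \<Rightarrow> 'b \<Rightarrow> 'b \<Rightarrow> real" where
  "weight_corr B p x y =
     measure_pmf.expectation (random_column B p) (\<lambda>h. column_weight B h x * column_weight B h y)"

definition weight_mean :: "'b set \<Rightarrow> real \<Rightarrow> 'b \<Rightarrow> real" where
  "weight_mean B p x =
     measure_pmf.expectation (random_column B p) (\<lambda>h. column_weight B h x)"

lemma expectation_random_column_permutes:
  assumes "finite B" "\<pi> permutes B"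
  shows "measure_pmf.expectation (random_column B p) (\<lambda>h. f (h \<circ> \<pi>)) =
    (measure_pmf.expectation (random_column B p) f :: real)"
  by (subst (2) random_column_permutes[OF assms, symmetric]) simp

lemma weight_mean_permutes:
  assumes "finite B" "\<pi> permutes B"
  shows "weight_mean B p (\<pi> x) = weight_mean B p x"
  unfolding weight_mean_def
  using expectation_random_column_permutes[OF assms, of p "\<lambda>h. column_weight B h x"]
  by (simp add: column_weight_comp_permutes[OF assms(2)])

lemma weight_corr_permutes:
  assumes "finite B" "\<pi> permutes B"
  shows "weight_corr B p (\<pi> x) (\<pi> y) = weight_corr B p x y"
  unfolding weight_corr_def
  using expectation_random_column_permutes[OF assms,
      of p "\<lambda>h. column_weight B h x * column_weight B h y"]
  by (simp add: column_weight_comp_permutes[OF assms(2)])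

lemma weight_mean_eq:
  assumes B: "finite B" and x: "x \<in> B" and p: "0 \<le> p" "p \<le> 1"
  shows "weight_mean B p x = 1 - (1 - p) ^ card B"
proof -
  have "weight_mean B p y = weight_mean B p x" if "y \<in> B" for y
    using weight_mean_permutes[OF B permutes_swap_id[OF x that], of p x] by simp
  then have "card B * weight_mean B p x = (\<Sum>y\<in>B. weight_mean B p y)"
    by simp
  also have "\<dots> = measure_pmf.expectation (random_column B p) (\<lambda>h. \<Sum>y\<in>B. column_weight B h y)"
    unfolding weight_mean_def
    by (subst Bochner_Integration.integral_sum) (auto intro: integrable_random_column B)
  also have "\<dots> = measure_pmf.expectation (random_column B p)
                     (\<lambda>h. real (card B) * indicator {h. \<exists>y\<in>B. h y} h)"
    by (simp add: sum_column_weight[OF B] indicator_def of_bool_def)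
  also have "\<dots> = card B * (1 - (1 - p) ^ card B)"
    using B p by (simp add: prob_random_column_nonempty)
  finally show ?thesis
    using B x by (auto simp: card_eq_0_iff)
qed

lemma weight_corr_diag_eq:
  assumes "finite B" "x \<in> B" "y \<in> B"
  shows "weight_corr B p y y = weight_corr B p x x"
  using weight_corr_permutes[OF assms(1) permutes_swap_id[OF assms(2,3)], of p x x] by simp

lemma weight_corr_offdiag_eq:
  assumes B: "finite B" and "x \<in> B" "y \<in> B" "x \<noteq> y" "x' \<in> B" "y' \<in> B" "x' \<noteq> y'"
  shows "weight_corr B p x' y' = weight_corr B p x y"
proof -
  define z where "z = Transposition.transpose x x' y"
  have z: "z \<in> B" "z \<noteq> x'"
    using assms by (auto simp: z_def Transposition.transpose_def)
  have "weight_corr B p x y = weight_corr B p x' z"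
    using weight_corr_permutes[OF B permutes_swap_id[of x B x'], of p x y] assms
    by (simp add: z_def)
  also have "\<dots> = weight_corr B p x' y'"
    using weight_corr_permutes[OF B permutes_swap_id[of z B y'], of p x' z] assms z
    by (simp add: Transposition.transpose_def)
  finally show ?thesis by simp
qed

lemma weight_corr_sum:
  fixes p :: real
  assumes "finite B" "x \<in> B" "0 \<le> p" "p \<le> 1"
  shows "(\<Sum>y\<in>B. weight_corr B p x y) = card B * (1 - (1 - p) ^ card B)"
proof -
  have "(\<Sum>y\<in>B. weight_corr B p x y) = measure_pmf.expectation (random_column B p)
           (\<lambda>h. \<Sum>y\<in>B. column_weight B h x * column_weight B h y)"
    unfolding weight_corr_def
    by (subst Bochner_Integration.integral_sum) (auto intro: integrable_random_column assms)
  also have "\<dots> = card B * weight_mean B p x"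
    by (simp add: column_weight_times_sum assms weight_mean_def)
  finally show ?thesis using assms by (simp add: weight_mean_eq)
qed

lemma weight_corr_nonneg: "weight_corr B p x y \<ge> 0"
  unfolding weight_corr_def by (intro Bochner_Integration.integral_nonneg) (simp add: column_weight_nonneg)

lemma weight_corr_le_diag:
  assumes B: "finite B" and "x \<in> B" "y \<in> B"
  shows "weight_corr B p x y \<le> weight_corr B p x x"
proof -
  have "0 \<le> measure_pmf.expectation (random_column B p)
               (\<lambda>h. (column_weight B h x - column_weight B h y)\<^sup>2)"
    by (intro Bochner_Integration.integral_nonneg) simp
  also have "\<dots> = measure_pmf.expectation (random_column B p)
      (\<lambda>h. column_weight B h x * column_weight B h x + column_weight B h y * column_weight B h y
           - 2 * (column_weight B h x * column_weight B h y))"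
    by (simp add: power2_eq_square algebra_simps)
  also have "\<dots> = weight_corr B p x x + weight_corr B p y y - 2 * weight_corr B p x y"
    unfolding weight_corr_def
    by (simp add: integrable_random_column[OF B])
  finally show ?thesis using weight_corr_diag_eq[OF assms, of p] by simp
qed

lemma expectation_inverse_binomial_le:
  fixes n :: nat and p :: real
  assumes p: "0 < p" "p \<le> 1"
  shows "measure_pmf.expectation (binomial_pmf n p) (\<lambda>s. 1 / real s)
           \<le> 1 / ((n + 1) * p) + 3 / ((n + 1) * (n + 2) * p\<^sup>2)"
proof -
  have aux1: "(\<Sum>k\<le>n. real (n choose k) * p ^ k * (1 - p) ^ (n - k) / (k + 1)) \<le> 1 / ((n + 1) * p)"
    (is "?L \<le> _")
  proof -
    have "?L * ((n + 1) * p) =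
        (\<Sum>k\<le>n. real (Suc n choose Suc k) * p ^ Suc k * (1 - p) ^ (Suc n - Suc k))"
      unfolding sum_distrib_right
    proof (intro sum.cong refl)
      fix k
      have "real (Suc n) * real (n choose k) = real (Suc k) * real (Suc n choose Suc k)"
        using Suc_times_binomial_eq[of n k] by (metis of_nat_mult mult.commute)
      then have 1: "real (n choose k) * real (Suc n) / real (Suc k) = real (Suc n choose Suc k)"
        by (simp add: divide_eq_eq mult_ac del: binomial_Suc_Suc of_nat_Suc)
      show "real (n choose k) * p ^ k * (1 - p) ^ (n - k) / (k + 1) * ((n + 1) * p) =
          real (Suc n choose Suc k) * p ^ Suc k * (1 - p) ^ (Suc n - Suc k)"
        unfolding 1[symmetric] by (simp add: add_ac)
    qed
    also have "\<dots> \<le> (\<Sum>k\<le>Suc n. real (Suc n choose k) * p ^ k * (1 - p) ^ (Suc n - k))"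
      using p by (subst sum.atMost_Suc_shift) (simp del: binomial_Suc_Suc power_Suc)
    also have "\<dots> = 1"
      using binomial_ring[of p "1 - p" "Suc n"] by simp
    finally show ?thesis using p by (subst pos_le_divide_eq) (auto intro!: mult_pos_pos add_pos_nonneg)
  qed
  have aux2: "(\<Sum>k\<le>n. real (n choose k) * p ^ k * (1 - p) ^ (n - k) / ((k + 1) * (k + 2)))
      \<le> 1 / ((n + 1) * (n + 2) * p\<^sup>2)"
    (is "?L \<le> _")
  proof -
    have "?L * ((n + 1) * (n + 2) * p\<^sup>2) =
        (\<Sum>k\<le>n. real (Suc (Suc n) choose Suc (Suc k)) * p ^ Suc (Suc k) *
                (1 - p) ^ (Suc (Suc n) - Suc (Suc k)))"
      unfolding sum_distrib_right
    proof (intro sum.cong refl)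
      fix k
      have 1: "real (Suc n) * real (n choose k) = real (Suc k) * real (Suc n choose Suc k)"
        using Suc_times_binomial_eq[of n k] by (metis of_nat_mult mult.commute)
      have 2: "real (Suc (Suc n)) * real (Suc n choose Suc k) =
          real (Suc (Suc k)) * real (Suc (Suc n) choose Suc (Suc k))"
        using Suc_times_binomial_eq[of "Suc n" "Suc k"] by (metis of_nat_mult mult.commute)
      have "real (n choose k) * (real (Suc n) * real (Suc (Suc n))) =
          real (Suc k) * (real (Suc (Suc n)) * real (Suc n choose Suc k))"
        using 1 by (simp add: algebra_simps del: binomial_Suc_Suc of_nat_Suc)
      also have "\<dots> = real (Suc k) * real (Suc (Suc k)) * real (Suc (Suc n) choose Suc (Suc k))"
        unfolding 2 by simp
      finally have 3: "real (n choose k) * (real (Suc n) * real (Suc (Suc n))) / (real (Suc k) * real (Suc (Suc k)))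
          = real (Suc (Suc n) choose Suc (Suc k))"
        by (simp add: divide_eq_eq mult_ac del: binomial_Suc_Suc of_nat_Suc)
      show "real (n choose k) * p ^ k * (1 - p) ^ (n - k) / ((k + 1) * (k + 2)) * ((n + 1) * (n + 2) * p\<^sup>2) =
          real (Suc (Suc n) choose Suc (Suc k)) * p ^ Suc (Suc k) *
                (1 - p) ^ (Suc (Suc n) - Suc (Suc k))"
        unfolding 3[symmetric] by (simp add: power2_eq_square algebra_simps)
    qed
    also have "\<dots> \<le> (\<Sum>k\<le>Suc (Suc n). real (Suc (Suc n) choose k) * p ^ k * (1 - p) ^ (Suc (Suc n) - k))"
      unfolding sum.atMost_Suc_shift[of _ "Suc n"] sum.atMost_Suc_shift[of _ n]
      using p by (simp del: binomial_Suc_Suc power_Suc)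
    also have "\<dots> = 1"
      using binomial_ring[of p "1 - p" "Suc (Suc n)"] by simp
    finally show ?thesis using p by (subst pos_le_divide_eq) (auto intro!: mult_pos_pos add_pos_nonneg)
  qed
  have le: "1 / real s \<le> 1 / (s + 1) + 3 / ((s + 1) * (s + 2))" for s :: nat
  proof (cases "s = 0")
    case False
    then have "1 / real s = 1 / (real s + 1) + 3 / ((real s + 1) * (3 * real s))"
      by (simp add: field_simps add_nonneg_eq_0_iff)
    also have "\<dots> \<le> 1 / (real s + 1) + 3 / ((real s + 1) * (real s + 2))"
      using False by (intro add_left_mono divide_left_mono mult_left_mono mult_pos_pos) auto
    finally show ?thesis by (simp add: algebra_simps)
  qed simp
  have "measure_pmf.expectation (binomial_pmf n p) (\<lambda>s. 1 / real s) \<le>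
        measure_pmf.expectation (binomial_pmf n p) (\<lambda>s. 1 / (s + 1) + 3 / ((s + 1) * (s + 2)))"
    using p le by (intro integral_mono) auto
  also have "\<dots> = (\<Sum>k\<le>n. real (n choose k) * p ^ k * (1 - p) ^ (n - k) / (k + 1)) +
      3 * (\<Sum>k\<le>n. real (n choose k) * p ^ k * (1 - p) ^ (n - k) / ((k + 1) * (k + 2)))"
    using p by (subst expectation_binomial_pmf')
      (auto simp: sum_distrib_left algebra_simps sum.distrib[symmetric] intro!: sum.cong)
  also have "\<dots> \<le> 1 / ((n + 1) * p) + 3 * (1 / ((n + 1) * (n + 2) * p\<^sup>2))"
    using aux1 aux2 by linarith
  finally show ?thesis by simp
qed

lemma weight_corr_diag_le:
  fixes p :: real
  assumes B: "finite B" and x: "x \<in> B" and p: "0 < p" "p \<le> 1"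
  shows "weight_corr B p x x \<le> 1 / p * (1 + 3 / (card B * p))"
proof -
  define n where "n = card B"
  have n: "n > 0" using B x by (auto simp: n_def card_gt_0_iff)
  have "n * weight_corr B p x x = (\<Sum>y\<in>B. weight_corr B p y y)"
    using weight_corr_diag_eq[OF B x, of _ p] by (simp add: n_def)
  also have "\<dots> = measure_pmf.expectation (random_column B p) (\<lambda>h. \<Sum>y\<in>B. (column_weight B h y)\<^sup>2)"
    unfolding weight_corr_def power2_eq_square
    by (subst Bochner_Integration.integral_sum) (auto intro: integrable_random_column B)
  also have "\<dots> = measure_pmf.expectation (random_column B p) (\<lambda>h. n\<^sup>2 * (1 / card {z\<in>B. h z}))"
    by (simp add: sum_column_weight_squared[OF B] n_def)
  also have "\<dots> = n\<^sup>2 * measure_pmf.expectation (random_column B p) (\<lambda>h. 1 / card {z\<in>B. h z})"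
    by (rule integral_mult_right_zero)
  also have "measure_pmf.expectation (random_column B p) (\<lambda>h. 1 / card {z\<in>B. h z}) =
      measure_pmf.expectation (binomial_pmf n p) (\<lambda>s. 1 / real s)"
    unfolding random_column_def using p
    by (subst binomial_pmf_altdef'[OF B n_def[symmetric], where dflt = False]) auto
  also have "n\<^sup>2 * \<dots> \<le> n\<^sup>2 * (1 / ((n + 1) * p) + 3 / ((n + 1) * (n + 2) * p\<^sup>2))"
    using p by (intro mult_left_mono expectation_inverse_binomial_le) auto
  finally have "weight_corr B p x x \<le> n * (1 / ((n + 1) * p) + 3 / ((n + 1) * (n + 2) * p\<^sup>2))"
    using n by (simp add: power2_eq_square mult.assoc)
  also have "\<dots> \<le> n * (1 / (n * p) + 3 / (real n * n * p\<^sup>2))"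
    using n p by (intro mult_left_mono add_mono divide_left_mono mult_right_mono mult_mono mult_pos_pos)
      (auto intro: add_pos_nonneg)
  also have "\<dots> = 1 / p * (1 + 3 / (n * p))"
    using n p by (simp add: field_simps power2_eq_square)
  finally show ?thesis by (simp add: n_def)
qed

section \<open>The second moment bound\<close>

lemma expectation_random_columns_prod:
  assumes "finite I" "finite B" "\<And>i h. f i h \<ge> 0"
  shows "measure_pmf.expectation (random_columns I B p) (\<lambda>g. \<Prod>i\<in>I. f i (g i)) =
           (\<Prod>i\<in>I. measure_pmf.expectation (random_column B p) (f i) :: real)"
  unfolding random_columns_def using assms
  by (intro expectation_prod_Pi_pmf integrable_random_column) auto

lemma integrable_random_columns:
  fixes f :: "_ \<Rightarrow> real"
  assumes "finite I" "finite B"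
  shows "integrable (random_columns I B p) f"
  unfolding random_columns_def using assms
  by (intro integrable_measure_pmf_finite)
    (auto simp: set_Pi_pmf finite_set_random_column intro!: finite_PiE_dflt)

lemma sum_Pow_power_card:
  fixes x y :: "'a :: comm_ring_1"
  assumes "finite I"
  shows "(\<Sum>T\<in>Pow I. x ^ card T * y ^ (card I - card T)) = (x + y) ^ card I"
proof -
  have "(x + y) ^ card I = (\<Prod>i\<in>I. x + y)" by simp
  also have "\<dots> = (\<Sum>T\<in>Pow I. (\<Prod>i\<in>T. x) * (\<Prod>i\<in>I - T. y))"
    by (rule prod_add[OF assms])
  also have "\<dots> = (\<Sum>T\<in>Pow I. x ^ card T * y ^ (card I - card T))"
    using assms by (intro sum.cong refl) (auto simp: card_Diff_subset finite_subset)
  finally show ?thesis ..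
qed

lemma average_prod_agreement_le:
  fixes \<beta> \<gamma> :: real
  assumes fin: "finite I" "finite J" and J: "card J \<ge> n ^ k" and n: "n > 0"
    and agree: "\<And>j T. j \<in> J \<Longrightarrow> T \<subseteq> I \<Longrightarrow>
       card {j'\<in>J. \<forall>i\<in>T. ev j' i = ev j i} \<le> (if card T \<le> k then n ^ (k - card T) else 1)"
    and \<gamma>: "0 \<le> \<gamma>" "\<gamma> \<le> \<beta>"
  shows "(\<Sum>j\<in>J. \<Sum>j'\<in>J. \<Prod>i\<in>I. if ev j' i = ev j i then \<beta> else \<gamma>) / (real (card J))\<^sup>2
     \<le> ((\<beta> + (real n - 1) * \<gamma>) / n) ^ card I + \<beta> ^ card I / n ^ k"
proof -
  define \<delta> where "\<delta> = \<beta> - \<gamma>"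
  have \<delta>: "\<delta> \<ge> 0" using \<gamma> by (simp add: \<delta>_def)
  define N where "N = real (card J)"
  have N: "N \<ge> real n ^ k" using J by (simp add: N_def flip: of_nat_power)
  have N0: "N > 0" using N n by (smt (verit) of_nat_0_less_iff zero_less_power)
  have row: "(\<Sum>j'\<in>J. \<Prod>i\<in>I. if ev j' i = ev j i then \<beta> else \<gamma>) \<le>
      n ^ k * (((\<beta> + (real n - 1) * \<gamma>) / n) ^ card I + \<beta> ^ card I / n ^ k)"
    if j: "j \<in> J" for j
  proof -
    have "(\<Sum>j'\<in>J. \<Prod>i\<in>I. if ev j' i = ev j i then \<beta> else \<gamma>) =
        (\<Sum>j'\<in>J. \<Prod>i\<in>I. \<delta> * of_bool (ev j' i = ev j i) + \<gamma>)"
      by (intro sum.cong prod.cong refl) (auto simp: \<delta>_def)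
    also have "\<dots> = (\<Sum>j'\<in>J. \<Sum>T\<in>Pow I. (\<Prod>i\<in>T. \<delta> * of_bool (ev j' i = ev j i)) * (\<Prod>i\<in>I - T. \<gamma>))"
      by (intro sum.cong refl prod_add fin)
    also have "\<dots> = (\<Sum>T\<in>Pow I. \<Sum>j'\<in>J. (\<Prod>i\<in>T. \<delta> * of_bool (ev j' i = ev j i)) * (\<Prod>i\<in>I - T. \<gamma>))"
      by (rule sum.swap)
    also have "\<dots> = (\<Sum>T\<in>Pow I. \<delta> ^ card T * \<gamma> ^ (card I - card T) *
                        card {j'\<in>J. \<forall>i\<in>T. ev j' i = ev j i})"
    proof (intro sum.cong refl)
      fix T assume "T \<in> Pow I"
      then have T: "T \<subseteq> I" "finite T" using fin finite_subset by auto
      have ob: "(\<Prod>i\<in>T. of_bool (ev j' i = ev j i) :: real) = of_bool (\<forall>i\<in>T. ev j' i = ev j i)" for j'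
        using T(2) by (auto simp: of_bool_def prod_zero_iff intro: prod.neutral)
      have "(\<Sum>j'\<in>J. (\<Prod>i\<in>T. \<delta> * of_bool (ev j' i = ev j i)) * (\<Prod>i\<in>I - T. \<gamma>)) =
          (\<Sum>j'\<in>J. \<delta> ^ card T * \<gamma> ^ (card I - card T) * of_bool (\<forall>i\<in>T. ev j' i = ev j i))"
        using T fin by (intro sum.cong refl) (simp add: prod.distrib ob card_Diff_subset)
      also have "\<dots> = \<delta> ^ card T * \<gamma> ^ (card I - card T) *
          (\<Sum>j'\<in>J. of_bool (\<forall>i\<in>T. ev j' i = ev j i))"
        by (rule sum_distrib_left[symmetric])
      also have "(\<Sum>j'\<in>J. of_bool (\<forall>i\<in>T. ev j' i = ev j i)) = real (card {j'\<in>J. \<forall>i\<in>T. ev j' i = ev j i})"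
        using fin by (simp add: of_bool_def sum.If_cases Int_def)
      finally show "(\<Sum>j'\<in>J. (\<Prod>i\<in>T. \<delta> * of_bool (ev j' i = ev j i)) * (\<Prod>i\<in>I - T. \<gamma>)) =
          \<delta> ^ card T * \<gamma> ^ (card I - card T) * card {j'\<in>J. \<forall>i\<in>T. ev j' i = ev j i}" .
    qed
    also have "\<dots> \<le> (\<Sum>T\<in>Pow I. \<delta> ^ card T * \<gamma> ^ (card I - card T) * (real n ^ k * (1 / real n) ^ card T + 1))"
    proof (intro sum_mono mult_left_mono)
      fix T assume "T \<in> Pow I"
      then have "T \<subseteq> I" by simp
      have "real (card {j'\<in>J. \<forall>i\<in>T. ev j' i = ev j i}) \<le> real (if card T \<le> k then n ^ (k - card T) else 1)"
        by (subst of_nat_le_iff) (rule agree[OF j \<open>T \<subseteq> I\<close>])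
      also have "\<dots> \<le> real n ^ k * (1 / real n) ^ card T + 1"
      proof (cases "card T \<le> k")
        case True
        then have "real n ^ (k - card T) = real n ^ k * (1 / real n) ^ card T"
          using n by (simp add: power_diff power_one_over)
        then show ?thesis using True by simp
      qed simp
      finally show "real (card {j'\<in>J. \<forall>i\<in>T. ev j' i = ev j i}) \<le> real n ^ k * (1 / real n) ^ card T + 1" .
    qed (use \<gamma> \<delta> in auto)
    also have "\<dots> = n ^ k * (\<Sum>T\<in>Pow I. (\<delta> / n) ^ card T * \<gamma> ^ (card I - card T)) +
        (\<Sum>T\<in>Pow I. \<delta> ^ card T * \<gamma> ^ (card I - card T))"
      by (simp add: sum_distrib_left algebra_simps sum.distrib power_divide)
    also have "\<dots> = n ^ k * (\<delta> / n + \<gamma>) ^ card I + \<beta> ^ card I"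
      by (simp add: sum_Pow_power_card fin) (simp add: \<delta>_def)
    also have "\<delta> / n + \<gamma> = (\<beta> + (real n - 1) * \<gamma>) / n"
      using n by (simp add: \<delta>_def field_simps)
    finally show ?thesis using n by (simp add: distrib_left)
  qed
  define A where "A = ((\<beta> + (real n - 1) * \<gamma>) / n) ^ card I + \<beta> ^ card I / n ^ k"
  have "A \<ge> 0" using \<gamma> n by (auto simp: A_def)
  have "(\<Sum>j\<in>J. \<Sum>j'\<in>J. \<Prod>i\<in>I. if ev j' i = ev j i then \<beta> else \<gamma>) \<le> (\<Sum>j\<in>J. n ^ k * A)"
    unfolding A_def by (intro sum_mono row)
  also have "\<dots> = N * (real n ^ k * A)" by (simp add: N_def)
  also have "\<dots> \<le> N * (N * A)"
    using N N0 \<open>A \<ge> 0\<close> by (intro mult_left_mono mult_right_mono) auto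
  finally show ?thesis
    using N0 unfolding A_def[symmetric] N_def[symmetric]
    by (simp add: divide_le_eq power2_eq_square mult_ac)
qed

lemma prob_columns_contain_ge:
  fixes p :: real
  assumes fin: "finite I" "finite B" "finite J" and B: "card B \<ge> 2" and p: "0 < p" "p \<le> 1"
    and ev: "\<And>j i. j \<in> J \<Longrightarrow> i \<in> I \<Longrightarrow> ev j i \<in> B"
    and J: "card J \<ge> card B ^ k"
    and agree: "\<And>j T. j \<in> J \<Longrightarrow> T \<subseteq> I \<Longrightarrow>
       card {j'\<in>J. \<forall>i\<in>T. ev j' i = ev j i} \<le> (if card T \<le> k then card B ^ (k - card T) else 1)"
  shows "measure_pmf.prob (random_columns I B p) {g. \<exists>j\<in>J. \<forall>i\<in>I. g i (ev j i)} \<ge>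
           (1 - (1 - p) ^ card B) ^ card I - (1 / p * (1 + 3 / (card B * p))) ^ card I / card B ^ k"
proof -
  define n where "n = card B"
  define m where "m = 1 - (1 - p) ^ n"
  define N where "N = real (card J)"
  have n: "n > 0" using B by (simp add: n_def)
  have N0: "N > 0"
    using J n by (metis N_def n_def not_gr_zero le_0_eq of_nat_0_less_iff power_not_zero)
  obtain x where x: "x \<in> B" using B by fastforce
  have "\<not> B \<subseteq> {x}" using card_mono[of "{x}" B] B by auto
  then obtain y where y: "y \<in> B" "y \<noteq> x" by blast
  define \<beta> where "\<beta> = weight_corr B p x x"
  define \<gamma> where "\<gamma> = weight_corr B p x y"
  have corr: "weight_corr B p u v = (if v = u then \<beta> else \<gamma>)" if "u \<in> B" "v \<in> B" for u v
    using that x y weight_corr_diag_eq[OF fin(2), of x u p]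
      weight_corr_offdiag_eq[OF fin(2), of x y u v p] by (auto simp: \<beta>_def \<gamma>_def)
  have \<gamma>: "0 \<le> \<gamma>" "\<gamma> \<le> \<beta>"
    unfolding \<beta>_def \<gamma>_def using x y fin by (auto intro: weight_corr_nonneg weight_corr_le_diag)
  have "n * m = (\<Sum>z\<in>B. weight_corr B p x z)"
    using weight_corr_sum[OF fin(2) x, of p] p by (simp add: n_def m_def)
  also have "\<dots> = \<beta> + (\<Sum>z\<in>B - {x}. weight_corr B p x z)"
    using x fin by (simp add: sum.remove \<beta>_def)
  also have "(\<Sum>z\<in>B - {x}. weight_corr B p x z) = (\<Sum>z\<in>B - {x}. \<gamma>)"
    using corr x by (intro sum.cong) auto
  also have "\<dots> = (real n - 1) * \<gamma>"
    using x fin n by (simp add: n_def of_nat_diff Suc_leI)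
  finally have m: "m = (\<beta> + (real n - 1) * \<gamma>) / n"
    using n by (simp add: field_simps)
  define E where "E = (\<lambda>f. measure_pmf.expectation (random_columns I B p) f :: real)"
  define w where "w = (\<lambda>j g. \<Prod>i\<in>I. column_weight B (g i) (ev j i))"
  define Y where "Y = (\<lambda>g. (\<Sum>j\<in>J. w j g) / N)"
  note integrable = integrable_random_columns[OF fin(1,2)]
  have "E (w j) = m ^ card I" if "j \<in> J" for j
  proof -
    have "E (w j) = (\<Prod>i\<in>I. weight_mean B p (ev j i))"
      unfolding E_def w_def weight_mean_def
      by (intro expectation_random_columns_prod fin column_weight_nonneg)
    also have "\<dots> = (\<Prod>i\<in>I. m)"
      using p that by (intro prod.cong) (auto simp: weight_mean_eq fin ev m_def n_def)
    finally show ?thesis by simp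
  qed
  moreover have "E Y = (\<Sum>j\<in>J. E (w j)) / N"
    unfolding E_def Y_def by (simp add: integrable)
  ultimately have EY: "E Y = m ^ card I"
    using N0 by (simp add: N_def)
  have Eww: "E (\<lambda>g. w j g * w j' g) = (\<Prod>i\<in>I. if ev j' i = ev j i then \<beta> else \<gamma>)"
    if "j \<in> J" "j' \<in> J" for j j'
  proof -
    have "E (\<lambda>g. w j g * w j' g) = (\<Prod>i\<in>I. weight_corr B p (ev j i) (ev j' i))"
      unfolding E_def w_def weight_corr_def prod.distrib[symmetric]
      by (intro expectation_random_columns_prod fin mult_nonneg_nonneg column_weight_nonneg)
    also have "\<dots> = (\<Prod>i\<in>I. if ev j' i = ev j i then \<beta> else \<gamma>)"
      using that by (intro prod.cong) (auto simp: corr ev)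
    finally show ?thesis .
  qed
  have "E (\<lambda>g. (Y g)\<^sup>2) = E (\<lambda>g. (\<Sum>j\<in>J. \<Sum>j'\<in>J. w j g * w j' g) / N\<^sup>2)"
    by (simp add: Y_def power2_eq_square sum_product)
  also have "\<dots> = (\<Sum>j\<in>J. \<Sum>j'\<in>J. E (\<lambda>g. w j g * w j' g)) / N\<^sup>2"
    unfolding E_def by (simp add: integrable)
  also have "\<dots> = (\<Sum>j\<in>J. \<Sum>j'\<in>J. \<Prod>i\<in>I. if ev j' i = ev j i then \<beta> else \<gamma>) / (real (card J))\<^sup>2"
    by (simp add: Eww N_def)
  also have "\<dots> \<le> ((\<beta> + (real n - 1) * \<gamma>) / n) ^ card I + \<beta> ^ card I / n ^ k"
    using fin J n agree \<gamma> unfolding n_def by (intro average_prod_agreement_le) auto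
  finally have EY2: "E (\<lambda>g. (Y g)\<^sup>2) \<le> m ^ card I + \<beta> ^ card I / n ^ k"
    by (simp add: m)
  define G where "G = {g. \<exists>j\<in>J. \<forall>i\<in>I. g i (ev j i)}"
  have Y0: "Y g = 0" if "g \<notin> G" for g
  proof -
    have "w j g = 0" if "j \<in> J" for j
    proof -
      from \<open>g \<notin> G\<close> that obtain i where "i \<in> I" "\<not> g i (ev j i)" by (auto simp: G_def)
      then show ?thesis
        using fin unfolding w_def by (auto intro!: column_weight_eq_0)
    qed
    then show ?thesis by (simp add: Y_def)
  qed
  \<comment> \<open>Comparing the indicator of \<open>Y = 0\<close> with \<open>(1 - Y)\<^sup>2\<close> spares the division by \<open>E Y\<close> in Chebyshev's inequality.\<close>
  have "1 - measure_pmf.prob (random_columns I B p) G = E (indicator (- G))"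
    using measure_pmf.prob_compl[of G "random_columns I B p"]
    by (simp add: E_def Compl_eq_Diff_UNIV)
  also have "\<dots> \<le> E (\<lambda>g. 1 - 2 * Y g + (Y g)\<^sup>2)"
    unfolding E_def
  proof (intro integral_mono integrable)
    fix g
    have "0 \<le> (1 - Y g)\<^sup>2" by simp
    then show "indicator (- G) g \<le> 1 - 2 * Y g + (Y g)\<^sup>2"
      using Y0[of g] by (auto simp: indicator_def power2_eq_square algebra_simps)
  qed
  also have "\<dots> = 1 - 2 * E Y + E (\<lambda>g. (Y g)\<^sup>2)"
    unfolding E_def by (simp add: integrable)
  also have "\<dots> \<le> 1 - m ^ card I + \<beta> ^ card I / n ^ k"
    using EY EY2 by simp
  also have "\<beta> ^ card I / n ^ k \<le> (1 / p * (1 + 3 / (n * p))) ^ card I / n ^ k"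
    unfolding n_def using \<gamma> weight_corr_diag_le[OF fin(2) x p]
    by (intro divide_right_mono power_mono) (auto simp: \<beta>_def)
  finally show ?thesis by (simp add: G_def m_def n_def)
qed

section \<open>Polynomials of bounded length over a finite field\<close>

definition polys_length_le :: "('a, 'm) ring_scheme \<Rightarrow> nat \<Rightarrow> 'a list set" where
  "polys_length_le R k = {P \<in> carrier (univ_poly R (carrier R)). length P \<le> k}"

lemma polys_length_le_mono: "k \<le> l \<Longrightarrow> polys_length_le R k \<subseteq> polys_length_le R l"
  by (auto simp: polys_length_le_def)

lemma AP_iff_polys_length_le:
  assumes "r * real (card (carrier R)) \<in> \<int>"
  shows "AP R r S \<longleftrightarrow> (\<exists>P\<in>polys_length_le R (nat (\<lfloor>r * real (card (carrier R))\<rfloor> + 1)).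
            \<forall>a\<in>carrier R. (a, ring.eval R P a) \<in> S)"
proof -
  obtain d where d: "r * real (card (carrier R)) = of_int d"
    using assms by (auto elim: Ints_cases)
  have "P = [] \<or> real (Polynomials.degree P) \<le> of_int d \<longleftrightarrow> length P \<le> nat (d + 1)" for P :: "'a list"
  proof (cases P)
    case (Cons a l)
    have "real (length l) \<le> of_int d \<longleftrightarrow> int (length l) \<le> d"
      by (metis of_int_le_iff of_int_of_nat_eq)
    then show ?thesis using Cons by auto
  qed simp
  then show ?thesis
    unfolding AP_def polys_length_le_def d by auto
qed

context field
begin

lemma eval_polys_length_le_in_carrier:
  assumes "P \<in> polys_length_le R k" "a \<in> carrier R"
  shows "eval P a \<in> carrier R"
  using assms eval_poly_in_carrier[OF carrier_is_subring, of P a]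
  by (simp add: polys_length_le_def univ_poly_carrier)

lemma finite_polys_length_le:
  assumes "finite (carrier R)"
  shows "finite (polys_length_le R k)"
proof (rule finite_subset)
  show "polys_length_le R k \<subseteq> {P. set P \<subseteq> carrier R \<and> length P \<le> k}"
    by (auto simp: polys_length_le_def polynomial_def simp flip: univ_poly_carrier)
qed (intro finite_lists_length_le assms)

lemma card_polys_length_le_ge:
  assumes fin: "finite (carrier R)"
  shows "card (polys_length_le R k) \<ge> card (carrier R) ^ k"
proof -
  let ?L = "{l. set l \<subseteq> carrier R \<and> length l = k}"
  have "inj_on normalize ?L"
  proof (rule inj_onI)
    fix l l' assume "l \<in> ?L" "l' \<in> ?L" "normalize l = normalize l'"
    then show "l = l'" using normalize_trick[of l] normalize_trick[of l'] by simp
  qed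
  moreover have "normalize ` ?L \<subseteq> polys_length_le R k"
  proof (rule image_subsetI)
    fix l assume "l \<in> ?L"
    then show "normalize l \<in> polys_length_le R k"
      using normalize_gives_polynomial[of l "carrier R"] normalize_length_le[of l]
      by (simp add: polys_length_le_def flip: univ_poly_carrier)
  qed
  ultimately have "card ?L \<le> card (polys_length_le R k)"
    by (rule card_inj_on_le) (rule finite_polys_length_le[OF fin])
  then show ?thesis
    using fin by (simp add: card_lists_length_eq)
qed

lemma polys_length_le_eqI:
  assumes P: "P \<in> polys_length_le R k" and Q: "Q \<in> polys_length_le R k"
    and T: "T \<subseteq> carrier R" "finite T" "card T \<ge> k"
    and eq: "\<And>a. a \<in> T \<Longrightarrow> eval P a = eval Q a"
  shows "P = Q"
proof -
  interpret UP: domain "poly_ring R"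
    using univ_poly_is_domain[OF carrier_is_subring] .
  have PQ: "P \<in> carrier (poly_ring R)" "Q \<in> carrier (poly_ring R)" "length P \<le> k" "length Q \<le> k"
    using P Q by (auto simp: polys_length_le_def)
  define D where "D = P \<ominus>\<^bsub>poly_ring R\<^esub> Q"
  have D: "D \<in> carrier (poly_ring R)" using PQ by (simp add: D_def)
  have DQ: "D \<oplus>\<^bsub>poly_ring R\<^esub> Q = P"
    using PQ by (simp add: D_def a_minus_def UP.a_assoc UP.l_neg)
  have "D = []"
  proof (rule ccontr)
    assume "D \<noteq> []"
    have "length D \<le> k"
    proof -
      have "length (\<ominus>\<^bsub>poly_ring R\<^esub> Q) = length Q"
        using univ_poly_a_inv_length[OF carrier_is_subring PQ(2)] .
      then show ?thesis
        using poly_add_length_le[of P "\<ominus>\<^bsub>poly_ring R\<^esub> Q"] PQ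
        by (simp add: D_def a_minus_def univ_poly_add)
    qed
    have "T \<subseteq> set_mset (roots D)"
    proof
      fix a assume a: "a \<in> T"
      then have aR: "a \<in> carrier R" using T by auto
      note hom = ring_hom_memE[OF eval_is_hom[OF carrier_is_subring aR]]
      have "eval D a \<oplus> eval Q a = eval Q a"
        using hom(3)[OF D PQ(2)] eq[OF a] DQ by simp
      then have "eval D a = \<zero>"
        using hom(1)[OF D] hom(1)[OF PQ(2)] by (simp add: add.r_cancel_one)
      then show "a \<in> set_mset (roots D)"
        using roots_mem_iff_is_root[OF D] \<open>D \<noteq> []\<close> aR by (simp add: is_root_def)
    qed
    then have "card T \<le> card (set_mset (roots D))"
      by (intro card_mono) auto
    also have "\<dots> \<le> size (roots D)"
      using size_mset_mono[OF mset_set_set_mset_msubset[of "roots D"]] by simp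
    also have "\<dots> \<le> length D - 1" by (rule size_roots_le_degree[OF D])
    also have "\<dots> < k" using \<open>D \<noteq> []\<close> \<open>length D \<le> k\<close> by (cases D) auto
    finally show False using T by simp
  qed
  then show ?thesis
    using DQ UP.l_zero[OF PQ(2)] by (simp add: univ_poly_zero)
qed

lemma card_polys_agreeing_le:
  assumes fin: "finite (carrier R)" and k: "k \<le> card (carrier R)"
    and P: "P \<in> polys_length_le R k" and T: "T \<subseteq> carrier R"
  shows "card {Q \<in> polys_length_le R k. \<forall>a\<in>T. eval Q a = eval P a}
           \<le> (if card T \<le> k then card (carrier R) ^ (k - card T) else 1)"
proof -
  let ?A = "{Q \<in> polys_length_le R k. \<forall>a\<in>T. eval Q a = eval P a}"
  have finT: "finite T" using T fin finite_subset by auto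
  show ?thesis
  proof (cases "card T \<le> k")
    case True
    obtain T' where T': "T \<subseteq> T'" "T' \<subseteq> carrier R" "card T' = k"
      using exists_subset_between[OF True k T fin] by auto
    have finT': "finite T'" using T' fin finite_subset by auto
    have "inj_on (\<lambda>Q. restrict (eval Q) (T' - T)) ?A"
    proof (rule inj_onI)
      fix Q Q' assume Q: "Q \<in> ?A" "Q' \<in> ?A"
        and eq: "restrict (eval Q) (T' - T) = restrict (eval Q') (T' - T)"
      have "eval Q a = eval Q' a" if "a \<in> T'" for a
        using Q that fun_cong[OF eq, of a] by (cases "a \<in> T") auto
      then show "Q = Q'"
        using Q T' finT' by (intro polys_length_le_eqI[of Q k Q' T']) auto
    qed
    moreover have "(\<lambda>Q. restrict (eval Q) (T' - T)) ` ?A \<subseteq> (T' - T) \<rightarrow>\<^sub>E carrier R"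
    proof (intro image_subsetI restrict_PiE_iff[THEN iffD2] ballI)
      fix Q a assume "Q \<in> ?A" "a \<in> T' - T"
      then show "eval Q a \<in> carrier R"
        using T' by (intro eval_polys_length_le_in_carrier[of Q k]) auto
    qed
    ultimately have "card ?A \<le> card ((T' - T) \<rightarrow>\<^sub>E carrier R)"
      by (rule card_inj_on_le) (use finT' fin in \<open>auto intro: finite_PiE\<close>)
    also have "\<dots> = card (carrier R) ^ (k - card T)"
      using T' finT finT' by (simp add: card_funcsetE card_Diff_subset)
    finally show ?thesis using True by simp
  next
    case False
    have "Q = P" if "Q \<in> ?A" for Q
      using that P False T finT by (intro polys_length_le_eqI[of Q k P T]) auto
    then have "card ?A \<le> card {P}" by (intro card_mono) auto
    then show ?thesis using False by simp
  qed
qed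

lemma card_polys_length_le_le:
  assumes fin: "finite (carrier R)" and k: "k \<le> card (carrier R)"
  shows "card (polys_length_le R k) \<le> card (carrier R) ^ k"
proof -
  have "[] \<in> polys_length_le R k"
    by (simp add: polys_length_le_def univ_poly_zero_closed)
  from card_polys_agreeing_le[OF fin k this, of "{}"] show ?thesis by simp
qed

end

context
begin

interpretation pmf_as_function .

lemma pmf_bernoulli_truncated:
  "pmf (bernoulli_pmf p) b = (if b then min 1 (max 0 p) else 1 - min 1 (max 0 p))"
  by transfer simp

end

lemma bernoulli_pmf_le_0: "p \<le> 0 \<Longrightarrow> bernoulli_pmf p = return_pmf False"
  and bernoulli_pmf_ge_1: "p \<ge> 1 \<Longrightarrow> bernoulli_pmf p = return_pmf True"
  by (intro pmf_eqI; simp add: pmf_bernoulli_truncated indicator_def max_def)+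

context
  fixes R :: "('a, 'm) ring_scheme" (structure) and r :: real and q K :: nat
  assumes field: "field R" and card: "card (carrier R) = q" and q: "q > 0" and int: "r * real q \<in> \<int>"
  defines "K \<equiv> nat (\<lfloor>r * real q\<rfloor> + 1)"
begin

interpretation field R by (rule field)

lemma card_ge_2: "finite (carrier R)" "q \<ge> 2"
proof -
  show fin: "finite (carrier R)" using card q by (simp add: card_ge_0_finite)
  have "card {\<zero>, \<one>} \<le> q"
    unfolding card[symmetric] using fin by (intro card_mono) auto
  then show "q \<ge> 2" by simp
qed

lemma AP_prob_conv_columns:
  "AP_prob R r p = measure_pmf.prob (random_columns (carrier R) (carrier R) p)
     {g. \<exists>P\<in>polys_length_le R K. \<forall>a\<in>carrier R. g a (eval P a)}"
  unfolding AP_prob_def random_points_conv_columns[OF card_ge_2(1)]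
  using AP_iff_polys_length_le[of r R] int card
  by (simp add: K_def vimage_def)

lemma AP_prob_le_nonempty:
  fixes p :: real
  assumes "0 \<le> p" "p \<le> 1"
  shows "AP_prob R r p \<le> (1 - (1 - p) ^ q) ^ q"
  unfolding AP_prob_conv_columns
  using prob_columns_contain_le_nonempty[OF card_ge_2(1) card_ge_2(1) assms,
      of "polys_length_le R K" eval] card
  by (simp add: eval_polys_length_le_in_carrier)

lemma AP_prob_le_first_moment:
  fixes p :: real
  assumes "0 \<le> p" "p \<le> 1" "K \<le> q"
  shows "AP_prob R r p \<le> real q ^ K * p ^ q"
proof -
  have "AP_prob R r p \<le> card (polys_length_le R K) * p ^ q"
    unfolding AP_prob_conv_columns
    using prob_columns_contain_le_first_moment[OF card_ge_2(1) card_ge_2(1)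
        finite_polys_length_le[OF card_ge_2(1)] assms(1,2), of K eval] card
    by (simp add: eval_polys_length_le_in_carrier)
  also have "\<dots> \<le> real q ^ K * p ^ q"
    using card_polys_length_le_le[OF card_ge_2(1)] assms card
    by (intro mult_right_mono) (auto simp flip: of_nat_power)
  finally show ?thesis .
qed

lemma AP_prob_ge:
  fixes p :: real
  assumes p: "0 < p" "p \<le> 1" and k: "k \<le> K" "k \<le> q"
  shows "AP_prob R r p \<ge> (1 - (1 - p) ^ q) ^ q - (1 / p * (1 + 3 / (q * p))) ^ q / q ^ k"
proof -
  have "(1 - (1 - p) ^ q) ^ q - (1 / p * (1 + 3 / (q * p))) ^ q / q ^ k
      \<le> measure_pmf.prob (random_columns (carrier R) (carrier R) p)
          {g. \<exists>P\<in>polys_length_le R k. \<forall>a\<in>carrier R. g a (eval P a)}"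
    unfolding card[symmetric]
  proof (rule prob_columns_contain_ge)
    show "card {Q \<in> polys_length_le R k. \<forall>a\<in>T. eval Q a = eval P a}
        \<le> (if card T \<le> k then card (carrier R) ^ (k - card T) else 1)"
      if "P \<in> polys_length_le R k" "T \<subseteq> carrier R" for P T
      using card_polys_agreeing_le[OF card_ge_2(1) _ that] card k by simp
  qed (simp_all add: card_ge_2 card p card_polys_length_le_ge[unfolded card]
        finite_polys_length_le eval_polys_length_le_in_carrier)
  also have "\<dots> \<le> AP_prob R r p"
    unfolding AP_prob_conv_columns
    using polys_length_le_mono[OF k(1), of R]
    by (intro measure_pmf.finite_measure_mono) auto
  finally show ?thesis .
qed

lemma AP_prob_eq_0:
  assumes "p \<le> 0"
  shows "AP_prob R r p = 0"
proof -
  have "bernoulli_pmf p = bernoulli_pmf 0"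
    using assms by (simp add: bernoulli_pmf_le_0)
  then have "AP_prob R r p = AP_prob R r 0"
    by (simp add: AP_prob_def random_points_def)
  also have "\<dots> = 0"
    using AP_prob_le_nonempty[of 0] card_ge_2 
    by (simp add: AP_prob_def measure_le_0_iff power_0_left)
  finally show ?thesis .
qed

lemma AP_prob_eq_1:
  assumes "p \<ge> 1"
  shows "AP_prob R r p = 1"
proof -
  have "random_points R p = return_pmf (carrier R \<times> carrier R)"
    using card_ge_2(1) assms
    by (simp add: random_points_def Pi_pmf_return_pmf bernoulli_pmf_ge_1)
  moreover have "AP R r (carrier R \<times> carrier R)"
    unfolding AP_def by (intro bexI[of _ "[]"]) auto
  ultimately show ?thesis by (simp add: AP_prob_def)
qed

end

section \<open>The critical probability\<close>

definition critical_prob :: "nat \<Rightarrow> nat \<Rightarrow> real" where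
  "critical_prob K q =
     (if K = 0 then 1 - 1 / q else max (ln q / q) (q powr - (real (min K q) / q)))"

text \<open>The case \<open>K = 0\<close> arises from \<open>r < 0\<close>: only the zero polynomial is admissible.\<close>

lemma ln_of_nat_gt_1:
  assumes "q \<ge> 3"
  shows "ln (real q) > 1"
proof -
  have "ln (exp 1) < ln (real q)"
    using e_less_272 assms by (subst ln_less_cancel_iff) auto
  then show ?thesis by simp
qed

lemma powr_minus_ratio_power:
  assumes "q > 0"
  shows "(real q powr - (real k / real q)) ^ q = 1 / real q ^ k"
proof -
  have "(real q powr - (real k / real q)) ^ q = (real q powr - (real k / real q)) powr real q"
    using assms by (subst powr_realpow) auto
  also have "\<dots> = real q powr - real k"
    using assms by (simp add: powr_powr)
  also have "\<dots> = 1 / real q ^ k"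
    using assms by (simp only: powr_minus_divide) (simp add: powr_realpow)
  finally show ?thesis .
qed

lemma critical_prob_bounds:
  assumes "q \<ge> 2"
  shows "0 < critical_prob K q" "critical_prob K q < 1"
proof -
  have "ln (real q) < real q" using assms by (intro ln_less_self) auto
  moreover have "real q powr - (real (min K q) / q) < 1" if "K \<noteq> 0"
    using assms that by (simp add: powr_less_one)
  ultimately show "0 < critical_prob K q" "critical_prob K q < 1"
    using assms by (auto simp: critical_prob_def less_max_iff_disj field_simps)
qed

context
  fixes R :: "('a, 'm) ring_scheme" (structure) and r :: real and q K :: nat and \<epsilon> :: real
  assumes field: "field R" and card: "card (carrier R) = q" and q: "q \<ge> 3"
    and int: "r * real q \<in> \<int>" and \<epsilon>: "\<epsilon> > 0"
  defines "K \<equiv> nat (\<lfloor>r * real q\<rfloor> + 1)"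
begin

lemma q_pos: "q > 0"
  using q by simp

lemma AP_prob_below_critical:
  assumes "\<epsilon> < 1"
  shows "AP_prob R r (critical_prob K q * (1 - \<epsilon>))
           \<le> (1 - \<epsilon>) ^ q + exp (- (q * (1 - (1 - \<epsilon>) * ln q / q) ^ q))"
proof -
  define p where "p = critical_prob K q * (1 - \<epsilon>)"
  have crit: "0 < critical_prob K q" "critical_prob K q < 1"
    using critical_prob_bounds[of q] q by auto
  have p: "0 \<le> p" "p \<le> 1" "p \<le> 1 - \<epsilon>"
    using crit \<epsilon> assms by (auto simp: p_def intro: mult_le_one)
  note first_moment = AP_prob_le_first_moment[OF field card q_pos int p(1,2), folded K_def]
  have "K = 0 \<or> critical_prob K q = ln q / q \<or>
      critical_prob K q = q powr - (real (min K q) / q) \<and> ln q / q < q powr - (real (min K q) / q)"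
    by (auto simp add: critical_prob_def max_def)
  then consider "K = 0" | "critical_prob K q = ln q / q"
    | "critical_prob K q = q powr - (real (min K q) / q)" "ln q / q < q powr - (real (min K q) / q)"
    by blast
  then have "AP_prob R r p \<le> (1 - \<epsilon>) ^ q \<or>
      AP_prob R r p \<le> exp (- (q * (1 - (1 - \<epsilon>) * ln q / q) ^ q))"
  proof cases
    case 1
    then have "AP_prob R r p \<le> p ^ q" using first_moment by simp
    also have "\<dots> \<le> (1 - \<epsilon>) ^ q" using p by (intro power_mono) auto
    finally show ?thesis ..
  next
    case 2
    have "AP_prob R r p \<le> (1 - (1 - p) ^ q) ^ q"
      by (rule AP_prob_le_nonempty[OF field card q_pos int p(1,2)])
    also have "\<dots> \<le> exp (- ((1 - p) ^ q)) ^ q"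
      using p exp_ge_add_one_self[of "- ((1 - p) ^ q)"]
      by (intro power_mono) (auto simp: power_le_one)
    also have "\<dots> = exp (- (q * (1 - p) ^ q))"
      by (simp flip: exp_of_nat_mult)
    also have "\<dots> = exp (- (q * (1 - (1 - \<epsilon>) * ln q / q) ^ q))"
      using 2 by (simp add: p_def mult_ac)
    finally show ?thesis ..
  next
    case 3
    have "K < q"
    proof (rule ccontr)
      assume "\<not> K < q"
      then have "ln q / q < 1 / q" using 3 q by (simp add: powr_minus_divide min_absorb2)
      with ln_of_nat_gt_1[OF q] q show False by (simp add: field_simps)
    qed
    have "p ^ q = (1 - \<epsilon>) ^ q / q ^ K"
      using 3 \<open>K < q\<close> powr_minus_ratio_power[OF q_pos, of K] by (simp add: p_def power_mult_distrib)
    then show ?thesis using first_moment \<open>K < q\<close> q by simp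
  qed
  moreover have "(1 - \<epsilon>) ^ q \<ge> 0" "exp (- (q * (1 - (1 - \<epsilon>) * ln q / q) ^ q)) \<ge> 0"
    using assms by auto
  ultimately show ?thesis unfolding p_def by linarith
qed

lemma AP_prob_above_critical:
  assumes q\<epsilon>: "(1 - 1 / q) * (1 + \<epsilon>) \<ge> 1"
  shows "AP_prob R r (critical_prob K q * (1 + \<epsilon>))
           \<ge> 1 - q powr - \<epsilon> - ((1 + 3 / ln q) / (1 + \<epsilon>)) ^ q"
proof -
  define p where "p = critical_prob K q * (1 + \<epsilon>)"
  have lnq: "ln q > 1" by (rule ln_of_nat_gt_1[OF q])
  have "1 - q powr - \<epsilon> - ((1 + 3 / ln q) / (1 + \<epsilon>)) ^ q \<le> AP_prob R r p"
  proof (cases "p \<ge> 1")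
    case True
    then have "AP_prob R r p = 1" by (rule AP_prob_eq_1[OF field card q_pos int])
    moreover have "q powr - \<epsilon> \<ge> 0" "((1 + 3 / ln q) / (1 + \<epsilon>)) ^ q \<ge> 0"
      using \<epsilon> lnq by auto
    ultimately show ?thesis by linarith
  next
    case False
    have "K \<noteq> 0"
    proof
      assume "K = 0"
      then show False using False q\<epsilon> by (simp add: p_def critical_prob_def)
    qed
    define k where "k = min K q"
    have crit: "critical_prob K q \<ge> ln q / q" "critical_prob K q \<ge> q powr - (k / q)"
      using \<open>K \<noteq> 0\<close> by (auto simp: critical_prob_def k_def)
    have p1: "p \<ge> (1 + \<epsilon>) * ln q / q"
      using crit(1) \<epsilon> mult_right_mono[of "ln q / q" "critical_prob K q" "1 + \<epsilon>"]
      by (simp add: p_def mult_ac)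
    have p2: "p \<ge> (1 + \<epsilon>) * q powr - (k / q)"
      using crit(2) \<epsilon> by (simp add: p_def mult_ac)
    have p0: "0 < p" "p \<le> 1"
      using False critical_prob_bounds[of q K] q \<epsilon> by (auto simp: p_def)
    have pq: "q * p \<ge> (1 + \<epsilon>) * ln q" using p1 q by (simp add: field_simps)
    have "(1 - p) ^ q \<le> exp (- p) ^ q"
      using p0 exp_ge_add_one_self[of "- p"] by (intro power_mono) auto
    also have "\<dots> = exp (- (q * p))"
      by (simp flip: exp_of_nat_mult)
    also have "\<dots> \<le> exp (- ((1 + \<epsilon>) * ln q))" using pq by simp
    also have "\<dots> = q powr - (1 + \<epsilon>)"
      using q by (simp add: powr_def algebra_simps)
    finally have "q * (1 - p) ^ q \<le> q * q powr - (1 + \<epsilon>)"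
      by (intro mult_left_mono) auto
    also have "\<dots> = q powr - \<epsilon>"
      using q by (simp add: powr_mult_base)
    finally have "1 - q powr - \<epsilon> \<le> 1 + q * (- ((1 - p) ^ q))" by simp
    also have "\<dots> \<le> (1 + (- ((1 - p) ^ q))) ^ q"
      using p0 by (intro Bernoulli_inequality) (simp add: power_le_one)
    finally have A: "1 - q powr - \<epsilon> \<le> (1 - (1 - p) ^ q) ^ q" by simp
    have "(1 + \<epsilon>) ^ q = ((1 + \<epsilon>) * q powr - (k / q)) ^ q * q ^ k"
      using q powr_minus_ratio_power[OF q_pos, of k] by (simp add: power_mult_distrib)
    also have "\<dots> \<le> p ^ q * q ^ k"
      using p2 \<epsilon> by (intro mult_right_mono power_mono) auto
    finally have B1: "(1 + \<epsilon>) ^ q \<le> p ^ q * real q ^ k" by simp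
    have "1 * ln q \<le> (1 + \<epsilon>) * ln q"
      using \<epsilon> lnq by (intro mult_right_mono) auto
    then have "ln q \<le> q * p" using pq by linarith
    then have B2: "3 / (q * p) \<le> 3 / ln q"
      using lnq q p0 by (intro divide_left_mono mult_pos_pos) auto
    have "(1 / p * (1 + 3 / (q * p))) ^ q / q ^ k = (1 + 3 / (q * p)) ^ q / (p ^ q * real q ^ k)"
      by (simp add: power_mult_distrib power_divide)
    also have "\<dots> \<le> (1 + 3 / ln q) ^ q / (1 + \<epsilon>) ^ q"
      using B1 B2 p0 \<epsilon> lnq by (intro frac_le power_mono) auto
    also have "\<dots> = ((1 + 3 / ln q) / (1 + \<epsilon>)) ^ q" by (simp add: power_divide)
    finally have B: "(1 / p * (1 + 3 / (q * p))) ^ q / q ^ k \<le> ((1 + 3 / ln q) / (1 + \<epsilon>)) ^ q" .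
    have "(1 - (1 - p) ^ q) ^ q - (1 / p * (1 + 3 / (q * p))) ^ q / q ^ k \<le> AP_prob R r p"
      using AP_prob_ge[OF field card q_pos int p0, of k] by (simp add: k_def K_def)
    then show ?thesis using A B by linarith
  qed
  then show ?thesis by (simp add: p_def)
qed

end

lemma below_critical_error_tendsto:
  fixes \<epsilon> :: real
  assumes "0 < \<epsilon>" "\<epsilon> < 1"
  shows "((\<lambda>q. (1 - \<epsilon>) ^ q + exp (- (real q * (1 - (1 - \<epsilon>) * ln (real q) / real q) ^ q))) \<longlongrightarrow> 0) at_top"
proof -
  have "\<forall>\<^sub>F q in at_top. ln (real q) / real q \<le> 1 / 2" by real_asymp
  then have "\<forall>\<^sub>F q in at_top. exp (- (real q * (1 - (1 - \<epsilon>) * ln (real q) / real q) ^ q)) \<le>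
      exp (- exp (\<epsilon> * ln (real q) - 2 * (ln (real q))\<^sup>2 / real q))"
    using eventually_ge_at_top[of 1]
  proof eventually_elim
    case (elim q)
    define L where "L = ln (real q)"
    define y where "y = (1 - \<epsilon>) * L / q"
    have L: "L \<ge> 0" "L / q \<ge> 0" "L / q \<le> 1 / 2" using elim by (auto simp: L_def)
    have "y = (1 - \<epsilon>) * (L / q)" by (simp add: y_def)
    also have "\<dots> \<le> L / q"
      using L assms by (intro mult_left_le_one_le) auto
    finally have y: "y \<le> 1 / 2" using L(3) by linarith
    have "0 \<le> y" using L assms by (simp add: y_def)
    have "q * (y + 2 * y\<^sup>2) = (1 - \<epsilon>) * L + 2 * ((1 - \<epsilon>)\<^sup>2 * (L\<^sup>2 / q))"
      using elim by (simp add: y_def field_simps power2_eq_square)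
    also have "\<dots> \<le> (1 - \<epsilon>) * L + 2 * (1 * (L\<^sup>2 / q))"
      using assms by (intro add_left_mono mult_left_mono mult_right_mono power_le_one) auto
    finally have "\<epsilon> * L - 2 * L\<^sup>2 / q \<le> L + q * (- y - 2 * y\<^sup>2)"
      by (simp add: algebra_simps)
    also have "\<dots> \<le> L + q * ln (1 - y)"
      using y \<open>0 \<le> y\<close> by (intro add_left_mono mult_left_mono ln_one_minus_pos_lower_bound) auto
    finally have "exp (\<epsilon> * L - 2 * L\<^sup>2 / q) \<le> exp (L + q * ln (1 - y))" by simp
    also have "\<dots> = q * (1 - y) ^ q"
      using elim y by (simp add: exp_add exp_of_nat_mult L_def)
    finally show ?case by (simp add: L_def y_def)
  qed
  moreover have "((\<lambda>q. exp (- exp (\<epsilon> * ln (real q) - 2 * (ln (real q))\<^sup>2 / real q))) \<longlongrightarrow> 0) at_top"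
    using assms by real_asymp
  ultimately have "((\<lambda>q. exp (- (real q * (1 - (1 - \<epsilon>) * ln (real q) / real q) ^ q))) \<longlongrightarrow> 0) at_top"
    by (rule tendsto_sandwich[OF _ _ tendsto_const, rotated]) simp
  moreover have "((\<lambda>q. (1 - \<epsilon>) ^ q) \<longlongrightarrow> 0) at_top"
    using assms by (intro LIMSEQ_realpow_zero) auto
  ultimately show ?thesis using tendsto_add by fastforce
qed

lemma above_critical_error_tendsto:
  fixes \<epsilon> :: real
  assumes "0 < \<epsilon>"
  shows "((\<lambda>q. 1 - real q powr - \<epsilon> - ((1 + 3 / ln (real q)) / (1 + \<epsilon>)) ^ q) \<longlongrightarrow> 1) at_top"
proof -
  have small: "\<forall>\<^sub>F q in at_top. 3 / ln (real q) < \<epsilon> / 2" using assms by real_asymp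
  have "\<forall>\<^sub>F q in at_top. 0 \<le> ((1 + 3 / ln (real q)) / (1 + \<epsilon>)) ^ q"
    using eventually_ge_at_top[of 1] by eventually_elim (use assms in simp)
  moreover have "\<forall>\<^sub>F q in at_top. ((1 + 3 / ln (real q)) / (1 + \<epsilon>)) ^ q \<le> ((1 + \<epsilon> / 2) / (1 + \<epsilon>)) ^ q"
    using eventually_ge_at_top[of 1] small
    by eventually_elim (use assms in \<open>auto intro!: power_mono divide_right_mono\<close>)
  moreover have "((\<lambda>q. ((1 + \<epsilon> / 2) / (1 + \<epsilon>)) ^ q) \<longlongrightarrow> 0) at_top"
    using assms by (intro LIMSEQ_realpow_zero) auto
  ultimately have "((\<lambda>q. ((1 + 3 / ln (real q)) / (1 + \<epsilon>)) ^ q) \<longlongrightarrow> 0) at_top"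
    by (rule tendsto_sandwich[OF _ _ tendsto_const])
  moreover have "((\<lambda>q. real q powr - \<epsilon>) \<longlongrightarrow> 0) at_top"
    using assms by real_asymp
  ultimately have "((\<lambda>q. 1 - real q powr - \<epsilon> - ((1 + 3 / ln (real q)) / (1 + \<epsilon>)) ^ q) \<longlongrightarrow> 1 - 0 - 0) at_top"
    by (intro tendsto_diff tendsto_const)
  then show ?thesis by simp
qed

lemma eventually_at_primepows:
  assumes "eventually P at_top" "\<And>q. primepow q \<Longrightarrow> P q \<Longrightarrow> Q q"
  shows "eventually Q at_primepows"
  unfolding at_primepows_def eventually_inf_principal
  using assms(1) by eventually_elim (use assms(2) in auto)

theorem mainTheorem4:
  fixes F :: "nat \<Rightarrow> ('a, 'm) ring_scheme"
    and r :: "nat \<Rightarrow> real"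
  assumes "\<And>q. primepow q \<Longrightarrow> field (F q) \<and> card (carrier (F q)) = q"
    and "\<And>q. primepow q \<Longrightarrow> r q * real q \<in> \<int>"
  shows "\<exists>p :: nat \<Rightarrow> real.
           (\<forall>q. primepow q \<longrightarrow> 0 < p q \<and> p q < 1) \<and>
           (\<forall>\<epsilon>>0.
              ((\<lambda>q. AP_prob (F q) (r q) (p q * (1 - \<epsilon>))) \<longlongrightarrow> 0) at_primepows \<and>
              ((\<lambda>q. AP_prob (F q) (r q) (p q * (1 + \<epsilon>))) \<longlongrightarrow> 1) at_primepows)"
proof -
  define p where "p = (\<lambda>q. critical_prob (nat (\<lfloor>r q * real q\<rfloor> + 1)) q)"
  have p: "0 < p q \<and> p q < 1" if "primepow q" for q
    using critical_prob_bounds primepow_gt_Suc_0[OF that] by (simp add: p_def)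
  have le: "at_primepows \<le> at_top" by (simp add: at_primepows_def)
  have nonneg: "0 \<le> AP_prob (F q) (r q) x" and le_1: "AP_prob (F q) (r q) x \<le> 1" for q x
    by (simp_all add: AP_prob_def)
  have below: "((\<lambda>q. AP_prob (F q) (r q) (p q * (1 - \<epsilon>))) \<longlongrightarrow> 0) at_primepows" if "\<epsilon> > 0" for \<epsilon>
  proof (cases "\<epsilon> < 1")
    case True
    have "\<forall>\<^sub>F q in at_primepows. AP_prob (F q) (r q) (p q * (1 - \<epsilon>)) \<le>
        (1 - \<epsilon>) ^ q + exp (- (real q * (1 - (1 - \<epsilon>) * ln (real q) / real q) ^ q))"
    proof (rule eventually_at_primepows[OF eventually_ge_at_top[of 3]])
      fix q :: nat assume "primepow q" "q \<ge> 3"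
      then show "AP_prob (F q) (r q) (p q * (1 - \<epsilon>)) \<le>
          (1 - \<epsilon>) ^ q + exp (- (real q * (1 - (1 - \<epsilon>) * ln (real q) / real q) ^ q))"
        unfolding p_def using assms \<open>\<epsilon> > 0\<close> True by (intro AP_prob_below_critical) auto
    qed
    moreover have "\<forall>\<^sub>F q in at_primepows. 0 \<le> AP_prob (F q) (r q) (p q * (1 - \<epsilon>))"
      by (simp add: nonneg)
    ultimately show ?thesis
      by (rule tendsto_sandwich[OF _ _ tendsto_const
          tendsto_mono[OF le below_critical_error_tendsto[OF \<open>\<epsilon> > 0\<close> True]], rotated])
  next
    case False
    have "p q * (1 - \<epsilon>) \<le> 0" if "primepow q" for q
      using p[OF that] False by (simp add: mult_le_0_iff)
    then have "AP_prob (F q) (r q) (p q * (1 - \<epsilon>)) = 0" if "primepow q" for q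
      using that assms primepow_gt_0_nat by (intro AP_prob_eq_0[of _ q]) auto
    then have "\<forall>\<^sub>F q in at_primepows. AP_prob (F q) (r q) (p q * (1 - \<epsilon>)) = 0"
      by (intro eventually_at_primepows[OF eventually_ge_at_top[of 3]]) auto
    then show ?thesis by (rule tendsto_eventually)
  qed
  have above: "((\<lambda>q. AP_prob (F q) (r q) (p q * (1 + \<epsilon>))) \<longlongrightarrow> 1) at_primepows" if "\<epsilon> > 0" for \<epsilon>
  proof -
    have "\<forall>\<^sub>F q in at_top. (1 - 1 / real q) * (1 + \<epsilon>) \<ge> 1"
      using that by real_asymp
    then have "\<forall>\<^sub>F q in at_top. (1 - 1 / real q) * (1 + \<epsilon>) \<ge> 1 \<and> q \<ge> 3"
      using eventually_ge_at_top[of 3] by eventually_elim auto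
    then have "\<forall>\<^sub>F q in at_primepows. 1 - real q powr - \<epsilon> - ((1 + 3 / ln (real q)) / (1 + \<epsilon>)) ^ q
        \<le> AP_prob (F q) (r q) (p q * (1 + \<epsilon>))"
    proof (rule eventually_at_primepows)
      fix q :: nat
      assume "primepow q" "(1 - 1 / real q) * (1 + \<epsilon>) \<ge> 1 \<and> q \<ge> 3"
      then show "1 - real q powr - \<epsilon> - ((1 + 3 / ln (real q)) / (1 + \<epsilon>)) ^ q
          \<le> AP_prob (F q) (r q) (p q * (1 + \<epsilon>))"
        unfolding p_def using assms that by (intro AP_prob_above_critical) auto
    qed
    moreover have "\<forall>\<^sub>F q in at_primepows. AP_prob (F q) (r q) (p q * (1 + \<epsilon>)) \<le> 1"
      by (simp add: le_1)
    ultimately show ?thesis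
      by (rule tendsto_sandwich[OF _ _
          tendsto_mono[OF le above_critical_error_tendsto[OF that]] tendsto_const])
  qed
  show ?thesis using p below above by blast
qed

end
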